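(* Let $n\ge 2$. If $f:\mathbb{B}^n\to\mathbb{B}^n=f(\mathbb{B}^n)$ is a Möbius transformation with $f(a)=0$ for some $a\in\mathbb{B}^n$, then for all distinct points $x,y\in\mathbb{B}^n$ $$\frac{1-|a|}{1+|a|}\,s_{\mathbb{B}^n}(x,y)\le s_{\mathbb{B}^n}(f(x),f(y))\le \frac{1+|a|}{1-|a|}\,s_{\mathbb{B}^n}(x,y).$$
   Context: $\mathbb{B}^n=\{x\in\mathbb{R}^n:|x|<1\}$. For a domain $G\subsetneq\mathbb{R}^n$ and $x,y\in G$, the triangular ratio metric is $$s_G(x,y)=\sup_{z\in\partial G}\frac{|x-y|}{|x-z|+|z-y|}.$$ *)

theory Defs
  imports "HOL-Analysis.Analysis"
begin

text \<open>
  The supremum is taken in the reals. For a domain that is a proper subset of the space, and for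
  points \<open>x\<close>, \<open>y\<close> of it, the frontier is nonempty and the quotients lie between \<open>0\<close> and \<open>1\<close>,
  so it is a genuine supremum.
\<close>

definition triangular_ratio :: "'a::euclidean_space set \<Rightarrow> 'a \<Rightarrow> 'a \<Rightarrow> real" where
  "triangular_ratio G x y = (SUP z\<in>frontier G. norm (x - y) / (norm (x - z) + norm (z - y)))"

text \<open>
  Points of the one-point compactification are represented by the option type: \<open>None\<close> is the
  point at infinity, and \<open>Some x\<close> is the finite point \<open>x\<close>.
\<close>

fun hyperplane_reflection ::
  "'a::euclidean_space \<Rightarrow> real \<Rightarrow> 'a option \<Rightarrow> 'a option" where
  "hyperplane_reflection u t None = None"
| "hyperplane_reflection u t (Some x) = Some (x - (2 * (x \<bullet> u - t) / (norm u)\<^sup>2) *\<^sub>R u)"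

fun sphere_inversion ::
  "'a::euclidean_space \<Rightarrow> real \<Rightarrow> 'a option \<Rightarrow> 'a option" where
  "sphere_inversion c r None = Some c"
| "sphere_inversion c r (Some x) =
     (if x = c then None else Some (c + (r / norm (x - c))\<^sup>2 *\<^sub>R (x - c)))"

text \<open>
  Moebius transformations of the compactified space are the finite compositions of reflections in
  hyperplanes and inversions in spheres; orientation-reversing maps are included.
\<close>

inductive moebius :: "('a::euclidean_space option \<Rightarrow> 'a option) \<Rightarrow> bool" where
  id: "moebius id"
| reflection: "moebius g \<Longrightarrow> u \<noteq> 0 \<Longrightarrow> moebius (hyperplane_reflection u t \<circ> g)"
| inversion: "moebius g \<Longrightarrow> r > 0 \<Longrightarrow> moebius (sphere_inversion c r \<circ> g)"

definition moebius_on :: "'a::euclidean_space set \<Rightarrow> ('a \<Rightarrow> 'a) \<Rightarrow> bool" where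
  "moebius_on D f \<longleftrightarrow> (\<exists>g. moebius g \<and> (\<forall>x\<in>D. g (Some x) = Some (f x)))"

end

theory Submission
  imports Defs
begin

text \<open>
  A Moebius transformation \<open>g\<close> distorts distances by a product of weights,
  \<open>|g u - g v| = \<sigma> u * \<sigma> v * |u - v|\<close>, where \<open>\<sigma>\<^sup>2\<close> is the local stretching factor. In the quotient
  that defines the triangular ratio metric these weights almost cancel: passing from the boundary
  point \<open>z\<close> to \<open>g z\<close> only replaces \<open>|x - z|\<close> and \<open>|z - y|\<close> by \<open>(\<sigma> z / \<sigma> y) * |x - z|\<close> and
  \<open>(\<sigma> z / \<sigma> x) * |z - y|\<close>. Hence \<open>g\<close> changes the metric by at most the
  oscillation factor \<open>sup \<sigma> / inf \<sigma>\<close> over the closed domain (\<open>triangular_ratio_weighted_image\<close>).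

  For a self-map of the unit ball this oscillation is at most \<open>(1 + |a|) / (1 - |a|)\<close>. If \<open>p\<close> is the
  pole of \<open>g\<close>, then \<open>\<sigma> u\<close> is proportional to \<open>1 / |u - p|\<close>, so the oscillation over the closed ball
  is \<open>(|p| + 1) / (|p| - 1)\<close>; if the pole is at infinity, then \<open>\<sigma>\<close> is constant. On the other hand
  \<open>g\<close> maps the unit sphere to itself and \<open>a\<close> to \<open>0\<close>, so \<open>1 = |g z - g a| = \<sigma> z * \<sigma> a * |z - a|\<close> for
  unit vectors \<open>z\<close>, which makes \<open>|z - p|\<close> proportional to \<open>|z - a|\<close> on the sphere. Comparing the two
  at the ends \<open>p / |p|\<close> and \<open>- p / |p|\<close> of the diameter through \<open>p\<close> gives
  \<open>(|p| + 1) / (|p| - 1) \<le> (1 + |a|) / (1 - |a|)\<close>, without computing \<open>p\<close>.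
\<close>

section \<open>The triangular ratio metric under weighted isometries\<close>

lemma triangular_ratio_upper:
  assumes "z \<in> frontier G"
  shows "norm (x - y) / (norm (x - z) + norm (z - y)) \<le> triangular_ratio G x y"
proof -
  have "norm (x - y) / (norm (x - w) + norm (w - y)) \<le> 1" for w
  proof -
    have "norm (x - y) \<le> norm (x - w) + norm (w - y)"
      using norm_triangle_ineq[of "x - w" "w - y"] by simp
    then show ?thesis
      using norm_ge_zero[of "x - w"] norm_ge_zero[of "w - y"] unfolding divide_le_eq_1 by linarith
  qed
  then have "bdd_above ((\<lambda>w. norm (x - y) / (norm (x - w) + norm (w - y))) ` frontier G)"
    by (intro bdd_aboveI2[of _ _ 1]) auto
  then show ?thesis
    unfolding triangular_ratio_def using assms by (rule cSUP_upper[rotated])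
qed

text \<open>
  The quotient for \<open>h x\<close>, \<open>h y\<close>, \<open>h z\<close> equals
  \<open>|x - y| / ((\<sigma> z / \<sigma> y) * |x - z| + (\<sigma> z / \<sigma> x) * |z - y|)\<close>, and both coefficients lie between
  \<open>1 / M\<close> and \<open>M\<close>. As \<open>h\<close> is onto the new boundary, the comparison passes to the suprema.
\<close>

lemma triangular_ratio_weighted_image:
  fixes h :: "'a::euclidean_space \<Rightarrow> 'a" and \<sigma> :: "'a \<Rightarrow> real"
  assumes ne: "frontier G \<noteq> {}" and onto: "h ` frontier G = frontier G'"
    and S: "S = {x, y} \<union> frontier G"
    and pos: "\<And>u. u \<in> S \<Longrightarrow> \<sigma> u > 0"
    and dist: "\<And>u v. u \<in> S \<Longrightarrow> v \<in> S \<Longrightarrow> norm (h u - h v) = \<sigma> u * \<sigma> v * norm (u - v)"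
    and osc: "\<And>u v. u \<in> S \<Longrightarrow> v \<in> S \<Longrightarrow> \<sigma> u \<le> M * \<sigma> v"
    and xy: "x \<noteq> y"
  shows "triangular_ratio G x y \<le> M * triangular_ratio G' (h x) (h y)"
    and "triangular_ratio G' (h x) (h y) \<le> M * triangular_ratio G x y"
proof -
  have inS: "x \<in> S" "y \<in> S" "\<And>z. z \<in> frontier G \<Longrightarrow> z \<in> S" using S by auto
  have M: "M > 0"
    using osc[OF inS(1) inS(1)] pos[OF inS(1)]
    by (metis less_le_trans zero_less_mult_pos2)
  have quot:
    "norm (x - y) / (norm (x - z) + norm (z - y))
       \<le> M * (norm (h x - h y) / (norm (h x - h z) + norm (h z - h y)))" (is "?q \<le> M * ?q'")
    "norm (h x - h y) / (norm (h x - h z) + norm (h z - h y))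
       \<le> M * (norm (x - y) / (norm (x - z) + norm (z - y)))"
    if z: "z \<in> frontier G" for z
  proof -
    define A B N where "A = norm (x - z)" and "B = norm (z - y)" and "N = norm (x - y)"
    note AB = A_def B_def N_def
    have nn: "A \<ge> 0" "B \<ge> 0" "N > 0" using xy by (auto simp: AB)
    moreover have "N \<le> A + B" using norm_triangle_ineq[of "x - z" "z - y"] by (simp add: AB)
    ultimately have sum: "A + B > 0" by simp
    note zS = inS(3)[OF z]
    have s: "\<sigma> x > 0" "\<sigma> y > 0" "\<sigma> z > 0" using pos inS zS by auto
    define D where "D = \<sigma> z * (\<sigma> x * A + \<sigma> y * B)"
    have D: "D > 0"
      using s nn sum unfolding D_def
      by (metis add_nonneg_eq_0_iff less_eq_real_def mult_eq_0_iff mult_nonneg_nonneg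
          mult_pos_pos order_less_irrefl add_nonneg_nonneg)
    have q: "?q = N / (A + B)" by (simp add: AB)
    have q': "?q' = \<sigma> x * \<sigma> y * N / D"
      using dist inS zS by (simp add: AB D_def algebra_simps)
    have "D \<le> M * (\<sigma> x * \<sigma> y * (A + B))"
    proof -
      have "\<sigma> z * (\<sigma> x * A) \<le> M * \<sigma> y * (\<sigma> x * A)" "\<sigma> z * (\<sigma> y * B) \<le> M * \<sigma> x * (\<sigma> y * B)"
        by (intro mult_right_mono osc zS inS mult_nonneg_nonneg; use s nn in simp)+
      then show ?thesis by (simp add: D_def algebra_simps)
    qed
    then have "N * D \<le> N * (M * (\<sigma> x * \<sigma> y * (A + B)))"
      using nn by (intro mult_left_mono) auto
    then show "?q \<le> M * ?q'"
      unfolding q q' using D sum by (simp add: field_simps)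
    have "\<sigma> x * \<sigma> y * (A + B) \<le> M * D"
    proof -
      have "\<sigma> y * (\<sigma> x * A) \<le> M * \<sigma> z * (\<sigma> x * A)" "\<sigma> x * (\<sigma> y * B) \<le> M * \<sigma> z * (\<sigma> y * B)"
        by (intro mult_right_mono osc zS inS mult_nonneg_nonneg; use s nn in simp)+
      then show ?thesis by (simp add: D_def algebra_simps)
    qed
    then have "N * (\<sigma> x * \<sigma> y * (A + B)) \<le> N * (M * D)"
      using nn by (intro mult_left_mono) auto
    then show "?q' \<le> M * ?q"
      unfolding q q' using D sum by (simp add: field_simps)
  qed
  show "triangular_ratio G x y \<le> M * triangular_ratio G' (h x) (h y)"
    unfolding triangular_ratio_def[of G]
  proof (rule cSUP_least[OF ne])
    fix z assume z: "z \<in> frontier G"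
    then have "h z \<in> frontier G'" using onto by blast
    from triangular_ratio_upper[OF this, of "h x" "h y"] quot(1)[OF z] M
    show "norm (x - y) / (norm (x - z) + norm (z - y)) \<le> M * triangular_ratio G' (h x) (h y)"
      by (meson mult_le_cancel_left_pos order_trans)
  qed
  have ne': "frontier G' \<noteq> {}" using ne onto by auto
  show "triangular_ratio G' (h x) (h y) \<le> M * triangular_ratio G x y"
    unfolding triangular_ratio_def[of G']
  proof (rule cSUP_least[OF ne'])
    fix w assume "w \<in> frontier G'"
    then obtain z where z: "z \<in> frontier G" "w = h z" using onto by blast
    from triangular_ratio_upper[OF z(1), of x y] quot(2)[OF z(1)] M
    show "norm (h x - h y) / (norm (h x - w) + norm (w - h y)) \<le> M * triangular_ratio G x y"
      unfolding z(2) by (meson mult_le_cancel_left_pos order_trans)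
  qed
qed

section \<open>Distortion of distances by Moebius transformations\<close>

text \<open>
  Giving a finite point the distance \<open>1\<close> from infinity makes the distortion formula for Moebius
  transformations hold on the whole compactified space, poles included, so that the formula is
  stable under composition. (This is the chordal distance up to a weight at each point.)
\<close>

fun ext_dist :: "'a::real_normed_vector option \<Rightarrow> 'a option \<Rightarrow> real" where
  "ext_dist (Some x) (Some y) = norm (x - y)"
| "ext_dist None None = 0"
| "ext_dist _ _ = 1"

lemma ext_dist_eq_0_iff: "ext_dist X Y = 0 \<longleftrightarrow> X = Y"
  by (cases "(X, Y)" rule: ext_dist.cases) auto

lemma ext_dist_nonneg: "ext_dist X Y \<ge> 0"
  by (cases "(X, Y)" rule: ext_dist.cases) auto

lemma hyperplane_reflection_dist:
  fixes u :: "'a::euclidean_space"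
  assumes "u \<noteq> 0"
  shows "ext_dist (hyperplane_reflection u t X) (hyperplane_reflection u t Y) = ext_dist X Y"
proof -
  have "norm (x - (2 * (x \<bullet> u - t) / (norm u)\<^sup>2) *\<^sub>R u - (y - (2 * (y \<bullet> u - t) / (norm u)\<^sup>2) *\<^sub>R u))
      = norm (x - y)" for x y
  proof -
    define d where "d = x - y"
    have "2 * (x \<bullet> u - t) / (norm u)\<^sup>2 - 2 * (y \<bullet> u - t) / (norm u)\<^sup>2 = 2 * (d \<bullet> u) / (u \<bullet> u)"
      by (simp add: d_def power2_norm_eq_inner inner_diff_left flip: diff_divide_distrib)
    moreover have "x - c *\<^sub>R u - (y - c' *\<^sub>R u) = d - (c - c') *\<^sub>R u" for c c'
      by (simp add: d_def scaleR_diff_left)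
    ultimately have "x - (2 * (x \<bullet> u - t) / (norm u)\<^sup>2) *\<^sub>R u - (y - (2 * (y \<bullet> u - t) / (norm u)\<^sup>2) *\<^sub>R u)
        = d - (2 * (d \<bullet> u) / (u \<bullet> u)) *\<^sub>R u"
      by presburger
    moreover have "norm (d - (2 * (d \<bullet> u) / (u \<bullet> u)) *\<^sub>R u) = norm d"
      using assms
      by (simp add: norm_eq inner_diff_left inner_diff_right inner_commute power2_eq_square)
    ultimately show ?thesis by (simp only: d_def)
  qed
  then show ?thesis by (cases "(X, Y)" rule: ext_dist.cases) auto
qed

lemma hyperplane_reflection_involution:
  fixes u :: "'a::euclidean_space"
  assumes "u \<noteq> 0"
  shows "hyperplane_reflection u t (hyperplane_reflection u t X) = X"
proof (cases X)
  case (Some x)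
  define c where "c = 2 * (x \<bullet> u - t) / (norm u)\<^sup>2"
  have "2 * ((x - c *\<^sub>R u) \<bullet> u - t) / (norm u)\<^sup>2 = - c"
    using assms by (simp add: c_def inner_diff_left power2_norm_eq_inner field_simps)
  then show ?thesis unfolding Some hyperplane_reflection.simps c_def[symmetric]
    by simp
qed simp

lemma norm_diff_inverse_points:
  fixes x y :: "'a::real_inner"
  assumes "x \<noteq> 0" "y \<noteq> 0"
  shows "norm ((r / norm x)\<^sup>2 *\<^sub>R x - (r / norm y)\<^sup>2 *\<^sub>R y) = r\<^sup>2 / (norm x * norm y) * norm (x - y)"
proof (rule power2_eq_imp_eq)
  define \<alpha> \<beta> where "\<alpha> = (r / norm x)\<^sup>2" and "\<beta> = (r / norm y)\<^sup>2"
  have "(norm (\<alpha> *\<^sub>R x - \<beta> *\<^sub>R y))\<^sup>2 = \<alpha>\<^sup>2 * (norm x)\<^sup>2 + \<beta>\<^sup>2 * (norm y)\<^sup>2 - 2 * (\<alpha> * \<beta>) * (x \<bullet> y)"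
    unfolding power2_norm_eq_inner
    by (simp add: inner_diff_left inner_diff_right inner_commute algebra_simps power2_eq_square)
  also have "\<alpha>\<^sup>2 * (norm x)\<^sup>2 = (r\<^sup>2 / (norm x * norm y))\<^sup>2 * (norm y)\<^sup>2"
    using assms by (simp add: \<alpha>_def power2_eq_square)
  also have "\<beta>\<^sup>2 * (norm y)\<^sup>2 = (r\<^sup>2 / (norm x * norm y))\<^sup>2 * (norm x)\<^sup>2"
    using assms by (simp add: \<beta>_def power2_eq_square)
  also have "\<alpha> * \<beta> = (r\<^sup>2 / (norm x * norm y))\<^sup>2"
    by (simp add: \<alpha>_def \<beta>_def power2_eq_square)
  also have "(r\<^sup>2 / (norm x * norm y))\<^sup>2 * (norm y)\<^sup>2 + (r\<^sup>2 / (norm x * norm y))\<^sup>2 * (norm x)\<^sup>2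
      - 2 * (r\<^sup>2 / (norm x * norm y))\<^sup>2 * (x \<bullet> y)
      = (r\<^sup>2 / (norm x * norm y))\<^sup>2 * ((norm x)\<^sup>2 + (norm y)\<^sup>2 - 2 * (x \<bullet> y))"
    by (simp only: distrib_left distrib_right right_diff_distrib mult_ac add_ac)
  also have "(norm x)\<^sup>2 + (norm y)\<^sup>2 - 2 * (x \<bullet> y) = (norm (x - y))\<^sup>2"
    by (simp add: power2_norm_eq_inner inner_diff_left inner_diff_right inner_commute)
  finally show "(norm ((r / norm x)\<^sup>2 *\<^sub>R x - (r / norm y)\<^sup>2 *\<^sub>R y))\<^sup>2
      = (r\<^sup>2 / (norm x * norm y) * norm (x - y))\<^sup>2"
    unfolding \<alpha>_def \<beta>_def power_mult_distrib[of _ "norm (x - y)"] .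
qed auto

text \<open>
  The weight of an inversion is \<open>r / |x - c|\<close> at a finite point other than \<open>c\<close>; its values
  \<open>1 / r\<close> at the centre and \<open>r\<close> at infinity are forced by the convention for the distance from
  infinity.
\<close>

lemma sphere_inversion_dist:
  fixes c :: "'a::euclidean_space"
  assumes "r > 0"
  shows "\<exists>\<sigma>. (\<forall>X. \<sigma> X > 0) \<and> (\<forall>X Y. ext_dist (sphere_inversion c r X) (sphere_inversion c r Y)
           = \<sigma> X * \<sigma> Y * ext_dist X Y)"
proof -
  define \<sigma> where "\<sigma> X = (case X of None \<Rightarrow> r | Some x \<Rightarrow> if x = c then 1 / r else r / norm (x - c))"
    for X
  have pos: "\<sigma> X > 0" for X using assms by (auto simp: \<sigma>_def split: option.split)
  have fin: "norm ((r / norm (x - c))\<^sup>2 *\<^sub>R (x - c) - (r / norm (y - c))\<^sup>2 *\<^sub>R (y - c))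
      = r\<^sup>2 / (norm (x - c) * norm (y - c)) * norm (x - y)" if "x \<noteq> c" "y \<noteq> c" for x y
    using norm_diff_inverse_points[of "x - c" "y - c" r] that by simp
  have "ext_dist (sphere_inversion c r X) (sphere_inversion c r Y) = \<sigma> X * \<sigma> Y * ext_dist X Y" for X Y
    using assms fin
    by (cases "(X, Y)" rule: ext_dist.cases)
       (auto simp: \<sigma>_def power2_eq_square norm_minus_commute)
  with pos show ?thesis by blast
qed

lemma sphere_inversion_involution:
  fixes c :: "'a::euclidean_space"
  assumes "r > 0"
  shows "sphere_inversion c r (sphere_inversion c r X) = X"
  using assms by (cases X) (auto simp: power2_eq_square)

lemma moebius_surj:
  assumes "moebius g"
  shows "surj g"
  using assms
proof induction
  case (reflection g u t)
  have "surj (hyperplane_reflection u t)"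
    by (rule surjI) (rule hyperplane_reflection_involution[OF reflection.hyps(2)])
  with reflection.IH show ?case by (rule comp_surj)
next
  case (inversion g r c)
  have "surj (sphere_inversion c r)"
    by (rule surjI) (rule sphere_inversion_involution[OF inversion.hyps(2)])
  with inversion.IH show ?case by (rule comp_surj)
qed simp

lemma moebius_dist:
  assumes "moebius g"
  shows "\<exists>\<sigma>. (\<forall>X. \<sigma> X > 0) \<and> (\<forall>X Y. ext_dist (g X) (g Y) = \<sigma> X * \<sigma> Y * ext_dist X Y)"
  using assms
proof induction
  case id
  show ?case by (rule exI[of _ "\<lambda>_. 1"]) simp
next
  case (reflection g u t)
  then show ?case unfolding comp_def hyperplane_reflection_dist[OF reflection.hyps(2)] by blast
next
  case (inversion g r c)
  obtain \<sigma> where \<sigma>: "\<forall>X. \<sigma> X > 0" "\<forall>X Y. ext_dist (g X) (g Y) = \<sigma> X * \<sigma> Y * ext_dist X Y"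
    using inversion.IH by blast
  obtain \<tau> where \<tau>: "\<forall>X. \<tau> X > 0"
    "\<forall>X Y. ext_dist (sphere_inversion c r X) (sphere_inversion c r Y) = \<tau> X * \<tau> Y * ext_dist X Y"
    using sphere_inversion_dist[OF inversion.hyps(2)] by blast
  show ?case
    by (rule exI[of _ "\<lambda>X. \<tau> (g X) * \<sigma> X"]) (use \<sigma> \<tau> in simp)
qed

text \<open>
  Comparing the distances of \<open>X\<close> and of the pole \<open>P\<close> with \<open>g P = \<infinity>\<close> determines the weight of \<open>g\<close>
  at \<open>X\<close>: it is inversely proportional to the distance from the pole.
\<close>

lemma moebius_dist_pole:
  assumes "moebius g"
  obtains k P where "k > 0" "g P = None" "\<And>X. g X = None \<Longrightarrow> X = P"
    "\<And>X Y x' y'. g X = Some x' \<Longrightarrow> g Y = Some y' \<Longrightarrow>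
       norm (x' - y') = k / (ext_dist X P * ext_dist Y P) * ext_dist X Y"
proof -
  obtain \<sigma> where \<sigma>: "\<And>X. \<sigma> X > 0" "\<And>X Y. ext_dist (g X) (g Y) = \<sigma> X * \<sigma> Y * ext_dist X Y"
    using moebius_dist[OF assms] by blast
  obtain P where P: "g P = None" using surjD[OF moebius_surj[OF assms], of None] by metis
  have uniq: "X = P" if "g X = None" for X
  proof -
    have "\<sigma> X * \<sigma> P * ext_dist X P = 0" using \<sigma>(2)[of X P] that P by simp
    then show ?thesis using \<sigma>(1)[of X] \<sigma>(1)[of P] by (simp add: ext_dist_eq_0_iff)
  qed
  have w: "\<sigma> X = 1 / (\<sigma> P * ext_dist X P)" if "g X = Some x'" for X x'
  proof -
    have "\<sigma> X * (\<sigma> P * ext_dist X P) = 1" using \<sigma>(2)[of X P] that P by simp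
    moreover from this have "\<sigma> P * ext_dist X P \<noteq> 0" by auto
    ultimately show ?thesis by (rule eq_divide_imp[rotated])
  qed
  show ?thesis
  proof (rule that[of "1 / (\<sigma> P)\<^sup>2" P])
    show "1 / (\<sigma> P)\<^sup>2 > 0" using \<sigma>(1)[of P] by simp
    fix X Y x' y' assume X: "g X = Some x'" and Y: "g Y = Some y'"
    have "norm (x' - y') = \<sigma> X * \<sigma> Y * ext_dist X Y" using \<sigma>(2)[of X Y] X Y by simp
    also have "\<sigma> X * \<sigma> Y = 1 / (\<sigma> P)\<^sup>2 / (ext_dist X P * ext_dist Y P)"
      unfolding w[OF X] w[OF Y] by (simp add: power2_eq_square mult_ac)
    finally show "norm (x' - y') = 1 / (\<sigma> P)\<^sup>2 / (ext_dist X P * ext_dist Y P) * ext_dist X Y" .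
  qed (rule P, erule uniq)
qed

section \<open>Moebius self-maps of the unit ball\<close>

text \<open>
  In the open ball \<open>g\<close> takes finite values, and near a pole on the sphere \<open>f\<close> would be unbounded.
\<close>

lemma pole_not_in_cball:
  fixes f :: "'a::euclidean_space \<Rightarrow> 'a"
  assumes g: "\<And>x. x \<in> ball 0 1 \<Longrightarrow> g (Some x) = Some (f x)" and f: "f ` ball 0 1 \<subseteq> ball 0 1"
    and k: "k > 0" and p: "g (Some p) = None"
    and dist: "\<And>x y. x \<in> ball 0 1 \<Longrightarrow> y \<in> ball 0 1 \<Longrightarrow>
       norm (f x - f y) = k / (norm (x - p) * norm (y - p)) * norm (x - y)"
  shows "norm p > 1"
proof (rule ccontr)
  assume "\<not> norm p > 1"
  then have pc: "p \<in> closure (ball 0 1)" by simp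
  have np: "p \<notin> ball 0 1" using g[of p] p by auto
  then have p0: "p \<noteq> 0" by auto
  \<comment> \<open>Both \<open>f x\<close> and \<open>f 0\<close> are in the unit ball, which bounds \<open>|f x - f 0|\<close> by \<open>2\<close>; the resulting
    inequality survives the passage to the limit \<open>x = p\<close>.\<close>
  have bd: "norm x \<le> 2 * norm p / k * norm (x - p)" if x: "x \<in> ball 0 1" for x
  proof -
    have xp: "norm (x - p) > 0" using x np by auto
    have "norm (f x - f 0) \<le> 2"
    proof -
      have "norm (f x) < 1" "norm (f 0) < 1" using f x by (force simp: image_subset_iff)+
      then show ?thesis using norm_triangle_ineq4[of "f x" "f 0"] by linarith
    qed
    then have "k / (norm (x - p) * norm p) * norm x \<le> 2" using dist[of x 0] x by simp
    then show ?thesis using xp p0 k by (simp add: field_simps)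
  qed
  have "closed {x. norm x \<le> 2 * norm p / k * norm (x - p)}"
    by (intro closed_Collect_le continuous_intros)
  then have "closure (ball 0 1) \<subseteq> {x. norm x \<le> 2 * norm p / k * norm (x - p)}"
    using bd by (intro closure_minimal) auto
  with pc have "norm p \<le> 0" by auto
  with p0 show False by simp
qed

text \<open>
  The image of the closed ball is compact and contains the open ball as a dense subset, so it is the
  closed ball. By injectivity the sphere has to fill what the open ball leaves uncovered.
\<close>

lemma sphere_image_of_ball_homeomorphism:
  fixes h :: "'a::euclidean_space \<Rightarrow> 'a"
  assumes cont: "continuous_on (cball 0 1) h" and inj: "inj_on h (cball 0 1)"
    and onto: "h ` ball 0 1 = ball 0 1"
  shows "h ` sphere 0 1 = sphere 0 1"
proof -
  have "compact (h ` cball 0 1)" using cont by (intro compact_continuous_image) auto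
  moreover have "ball 0 1 \<subseteq> h ` cball 0 1" using onto ball_subset_cball by blast
  ultimately have "cball 0 1 \<subseteq> h ` cball 0 1"
    by (metis closure_ball closure_minimal compact_imp_closed zero_less_one zero_neq_one)
  moreover have "h ` cball 0 1 \<subseteq> cball 0 1"
    using image_closure_subset[of "ball 0 1" h "cball 0 1"] cont onto by auto
  ultimately have "h ` cball 0 1 = cball 0 1" by blast
  moreover have "sphere 0 1 = cball 0 1 - ball (0::'a) 1" by auto
  moreover have "h ` (cball 0 1 - ball 0 1) = h ` cball 0 1 - h ` ball 0 1"
    using inj by (intro inj_on_image_set_diff[of _ "cball 0 1"]) auto
  ultimately show ?thesis using onto by simp
qed

text \<open>
  The largest and the smallest distance from \<open>p\<close> on the closed ball are \<open>|p| + 1\<close> and \<open>|p| - 1\<close>.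
  They are taken at the two ends of the diameter through \<open>p\<close>. These lie on the sphere, where the
  distance from \<open>p\<close> can be replaced by the distance from \<open>a\<close>, and the latter varies only between
  \<open>1 - |a|\<close> and \<open>1 + |a|\<close>.
\<close>

lemma pole_distance_oscillation:
  fixes a p :: "'a::euclidean_space"
  assumes a: "norm a < 1" and p: "norm p > 1"
    and sph: "\<And>z. norm z = 1 \<Longrightarrow> norm (z - p) = C * norm (z - a)"
    and x: "norm x \<le> 1" and y: "norm y \<le> 1"
  shows "norm (x - p) \<le> (1 + norm a) / (1 - norm a) * norm (y - p)"
proof -
  define e where "e = p /\<^sub>R norm p"
  have p0: "norm p \<noteq> 0" using p by linarith
  then have e: "norm e = 1" and pe: "p = norm p *\<^sub>R e" by (simp_all add: e_def)
  have "e - p = (1 - norm p) *\<^sub>R e" using pe by (metis scaleR_diff_left scaleR_one)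
  then have near: "norm (e - p) = norm p - 1" using e p by simp
  have "- e - p = - ((norm p + 1) *\<^sub>R e)"
    using pe by (metis add.commute minus_add_distrib scaleR_add_left scaleR_one uminus_add_conv_diff
        diff_conv_add_uminus)
  then have far: "norm (- e - p) = norm p + 1" using e p by simp
  have ae: "norm (e - a) \<ge> 1 - norm a" "norm (- e - a) \<le> 1 + norm a"
    using norm_triangle_ineq2[of e a] norm_triangle_ineq4[of "- e" a] e by auto
  have near_a: "norm p - 1 = C * norm (e - a)" and far_a: "norm p + 1 = C * norm (- e - a)"
    using sph[of e] sph[of "- e"] e near far by auto
  have C: "C \<ge> 0" using near_a p ae a by (smt (verit) mult_neg_pos)
  have "(norm p + 1) * (1 - norm a) \<le> C * (1 + norm a) * (1 - norm a)"
    unfolding far_a using ae C a by (intro mult_right_mono mult_left_mono) auto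
  also have "\<dots> \<le> (1 + norm a) * (norm p - 1)"
    unfolding near_a using mult_left_mono[OF ae(1), of "(1 + norm a) * C"] C
    by (simp add: algebra_simps)
  finally have "norm p + 1 \<le> (1 + norm a) / (1 - norm a) * (norm p - 1)"
    using a by (simp add: field_simps)
  moreover have "norm (x - p) \<le> norm p + 1" using norm_triangle_ineq4[of x p] x by simp
  moreover have "norm p - 1 \<le> norm (y - p)"
    using norm_triangle_ineq2[of p y] y by (simp add: norm_minus_commute)
  then have "(1 + norm a) / (1 - norm a) * (norm p - 1) \<le> (1 + norm a) / (1 - norm a) * norm (y - p)"
    using a by (intro mult_left_mono) auto
  ultimately show ?thesis by linarith
qed

text \<open>
  The pole lies outside the closed ball, so the Moebius transformation itself provides the extension
  \<open>h\<close> to the boundary. Its weight is inversely proportional to the distance \<open>\<rho>\<close> from the pole, and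
  \<open>|h z| = 1\<close> for unit vectors \<open>z\<close> shows that on the sphere \<open>\<rho>\<close> is proportional to the distance
  from \<open>a\<close>.
\<close>

lemma moebius_ball_weight:
  fixes f :: "'a::euclidean_space \<Rightarrow> 'a"
  assumes f: "moebius_on (ball 0 1) f" and onto: "f ` ball 0 1 = ball 0 1"
    and a: "a \<in> ball 0 1" and fa: "f a = 0"
  obtains h \<sigma> where "\<And>x. x \<in> ball 0 1 \<Longrightarrow> h x = f x" "h ` sphere 0 1 = sphere 0 1"
    "\<And>x. x \<in> cball 0 1 \<Longrightarrow> \<sigma> x > 0"
    "\<And>x y. x \<in> cball 0 1 \<Longrightarrow> y \<in> cball 0 1 \<Longrightarrow> norm (h x - h y) = \<sigma> x * \<sigma> y * norm (x - y)"
    "\<And>x y. x \<in> cball 0 1 \<Longrightarrow> y \<in> cball 0 1 \<Longrightarrow> \<sigma> x \<le> (1 + norm a) / (1 - norm a) * \<sigma> y"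
proof -
  obtain g where g: "moebius g" "\<And>x. x \<in> ball 0 1 \<Longrightarrow> g (Some x) = Some (f x)"
    using f by (auto simp: moebius_on_def)
  obtain k P where k: "k > 0" and P: "g P = None" "\<And>X. g X = None \<Longrightarrow> X = P"
    and dist: "\<And>X Y x' y'. g X = Some x' \<Longrightarrow> g Y = Some y' \<Longrightarrow>
       norm (x' - y') = k / (ext_dist X P * ext_dist Y P) * ext_dist X Y"
    by (fact moebius_dist_pole[OF g(1)])
  have pole: "norm p > 1" if Pp: "P = Some p" for p
  proof (rule pole_not_in_cball[where g = g and f = f and k = k])
    show "f ` ball 0 1 \<subseteq> ball 0 1" using onto by (rule equalityD1)
    show "g (Some p) = None" using P(1) Pp by simp
    show "norm (f x - f y) = k / (norm (x - p) * norm (y - p)) * norm (x - y)"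
      if "x \<in> ball 0 1" "y \<in> ball 0 1" for x y
      using dist[OF g(2) g(2), OF that] Pp by simp
  qed (fact g(2), fact k)
  define h where "h x = the (g (Some x))" for x
  define \<rho> where "\<rho> x = ext_dist (Some x) P" for x
  have outside: "Some x \<noteq> P" if "x \<in> cball 0 1" for x
    using pole[of x] that by auto
  have \<rho>: "\<rho> x > 0" if "x \<in> cball 0 1" for x
    using outside[OF that] ext_dist_nonneg[of "Some x" P] ext_dist_eq_0_iff[of "Some x" P]
    unfolding \<rho>_def by linarith
  have gh: "g (Some x) = Some (h x)" if "x \<in> cball 0 1" for x
    using outside[OF that] P(2)[of "Some x"] unfolding h_def by (cases "g (Some x)") auto
  have hf: "h x = f x" if "x \<in> ball 0 1" for x
    using g(2)[OF that] by (simp add: h_def)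
  have hdist: "norm (h x - h y) = k / (\<rho> x * \<rho> y) * norm (x - y)"
    if "x \<in> cball 0 1" "y \<in> cball 0 1" for x y
    using dist[OF gh gh, OF that] by (simp add: \<rho>_def)
  have inj: "inj_on h (cball 0 1)"
  proof (rule inj_onI)
    fix x y assume xy: "x \<in> cball 0 1" "y \<in> cball 0 1" "h x = h y"
    then have "k / (\<rho> x * \<rho> y) * norm (x - y) = 0" using hdist[OF xy(1,2)] by simp
    then show "x = y" using k \<rho>[OF xy(1)] \<rho>[OF xy(2)] by simp
  qed
  have "continuous_on (cball 0 1) \<rho>"
    unfolding \<rho>_def by (cases P) (auto intro!: continuous_intros)
  have cont: "continuous_on (cball 0 1) h"
    unfolding continuous_on_def
  proof
    fix x :: 'a assume x: "x \<in> cball 0 1"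
    have "((\<lambda>y. k / (\<rho> y * \<rho> x) * norm (y - x)) \<longlongrightarrow> k / (\<rho> x * \<rho> x) * norm (x - x)) (at x within cball 0 1)"
      using \<open>continuous_on (cball 0 1) \<rho>\<close> x \<rho>[OF x]
      by (intro tendsto_intros) (auto simp: continuous_on_def)
    moreover have "\<forall>\<^sub>F y in at x within cball 0 1. k / (\<rho> y * \<rho> x) * norm (y - x) = norm (h y - h x)"
      using x hdist by (auto simp: eventually_at_filter)
    ultimately have "((\<lambda>y. norm (h y - h x)) \<longlongrightarrow> 0) (at x within cball 0 1)"
      by (simp add: tendsto_cong)
    then show "(h \<longlongrightarrow> h x) (at x within cball 0 1)"
      by (simp add: tendsto_norm_zero_iff LIM_zero_iff)
  qed
  have "h ` ball 0 1 = ball 0 1" using onto hf image_cong[OF refl, of "ball 0 1" h f] by metis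
  then have sph: "h ` sphere 0 1 = sphere 0 1"
    by (rule sphere_image_of_ball_homeomorphism[OF cont inj])
  have a': "a \<in> cball 0 1" "norm a < 1" using a by auto
  have \<rho>_sph: "\<rho> z = k / \<rho> a * norm (z - a)" if "norm z = 1" for z
  proof -
    have z: "z \<in> cball 0 1" "z \<in> sphere 0 1" using that by auto
    then have "norm (h z) = 1" using sph by (metis image_eqI mem_sphere_0)
    then have "norm (h a - h z) = 1" using hf[OF a] fa by simp
    then have "(k / \<rho> a * norm (a - z)) / \<rho> z = 1"
      unfolding hdist[OF a'(1) z(1)] by (simp only: times_divide_eq_left divide_divide_eq_left)
    then show ?thesis using \<rho>[OF z(1)] by (metis divide_eq_1_iff norm_minus_commute)
  qed
  have osc: "\<rho> x \<le> (1 + norm a) / (1 - norm a) * \<rho> y"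
    if "x \<in> cball 0 1" "y \<in> cball 0 1" for x y
  proof (cases P)
    case None
    then show ?thesis using a' by (simp add: \<rho>_def)
  next
    case (Some p)
    then show ?thesis
      using pole_distance_oscillation[OF a'(2) pole[OF Some], of "k / \<rho> a" x y] \<rho>_sph that
      by (simp add: \<rho>_def)
  qed
  show ?thesis
  proof (rule that[of h "\<lambda>x. sqrt k / \<rho> x"])
    fix x y :: 'a assume xy: "x \<in> cball 0 1" "y \<in> cball 0 1"
    show "norm (h x - h y) = sqrt k / \<rho> x * (sqrt k / \<rho> y) * norm (x - y)"
      using hdist[OF xy] k by simp
    define M where "M = (1 + norm a) / (1 - norm a)"
    have "sqrt k * \<rho> y \<le> sqrt k * (M * \<rho> x)"
      using osc[OF xy(2) xy(1)] k unfolding M_def by (intro mult_left_mono) auto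
    then show "sqrt k / \<rho> x \<le> (1 + norm a) / (1 - norm a) * (sqrt k / \<rho> y)"
      unfolding M_def[symmetric] using \<rho>[OF xy(1)] \<rho>[OF xy(2)] by (simp add: field_simps)
  qed (use hf sph \<rho> k in auto)
qed

theorem theorem3p31:
  fixes f :: "real ^ 'n \<Rightarrow> real ^ 'n" and a x y :: "real ^ 'n"
  assumes "CARD('n) \<ge> 2"
    and "moebius_on (ball 0 1) f"
    and "f ` ball 0 1 = ball 0 1"
    and "a \<in> ball 0 1" and "f a = 0"
    and "x \<in> ball 0 1" and "y \<in> ball 0 1" and "x \<noteq> y"
  shows "(1 - norm a) / (1 + norm a) * triangular_ratio (ball 0 1) x y
           \<le> triangular_ratio (ball 0 1) (f x) (f y)
       \<and> triangular_ratio (ball 0 1) (f x) (f y)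
           \<le> (1 + norm a) / (1 - norm a) * triangular_ratio (ball 0 1) x y"
proof -
  obtain h \<sigma> where h: "\<And>x. x \<in> ball 0 1 \<Longrightarrow> h x = f x" "h ` sphere 0 1 = sphere 0 1"
    and \<sigma>: "\<And>x. x \<in> cball 0 1 \<Longrightarrow> \<sigma> x > 0"
      "\<And>x y. x \<in> cball 0 1 \<Longrightarrow> y \<in> cball 0 1 \<Longrightarrow> norm (h x - h y) = \<sigma> x * \<sigma> y * norm (x - y)"
      "\<And>x y. x \<in> cball 0 1 \<Longrightarrow> y \<in> cball 0 1 \<Longrightarrow> \<sigma> x \<le> (1 + norm a) / (1 - norm a) * \<sigma> y"
    by (fact moebius_ball_weight[OF assms(2-5)])
  have fr: "frontier (ball 0 1 :: (real ^ 'n) set) = sphere 0 1" by simp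
  define S where "S = {x, y} \<union> frontier (ball 0 1)"
  have sub: "u \<in> cball 0 1" if "u \<in> S" for u
    using that assms(6,7) by (auto simp: S_def fr)
  have ne: "frontier (ball 0 1 :: (real ^ 'n) set) \<noteq> {}" by simp
  have onto: "h ` frontier (ball 0 1) = frontier (ball 0 1)" unfolding fr by (rule h(2))
  note compare = triangular_ratio_weighted_image[OF ne onto S_def \<sigma>(1)[OF sub]
      \<sigma>(2)[OF sub sub] \<sigma>(3)[OF sub sub] assms(8), unfolded h(1)[OF assms(6)] h(1)[OF assms(7)]]
  have "norm a < 1" using assms(4) by simp
  moreover have "1 + norm a > 0" by (simp add: add_pos_nonneg)
  ultimately show ?thesis using compare by (simp add: field_simps)
qed

end
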